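(* For all integers $n\geq 0$ and $k>0$, $$(-1)^{k-1} \left( b_6(n) - \sum_{j=-k}^{k} (-1)^j\, p\big(n-3j(3j-1)\big) \right) = \sum_{j=0}^{\lfloor n/6 \rfloor} b_6(n-6j)\, \widetilde{P}_k(j).$$
   Context: $p(n)$ denotes the number of partitions of $n$, with $p(0)=1$ and $p(n)=0$ for $n<0$. A partition is called $6$-regular if none of its parts is divisible by $6$; $b_6(n)$ denotes the number of $6$-regular partitions of $n$ (with $b_6(0)=1$). $\widetilde{P}_k(n)$ denotes the number of partitions of $n$ in which every positive integer $\leq k$ appears as a part at least once and the first part larger than $k$ (that is, the smallest part exceeding $k$, which is required to exist) appears at least $k+1$ times. Equivalently, $\sum_{n\ge 0}\widetilde{P}_k(n)q^n=\frac{q^{k(k+1)/2}}{(q;q)_k}\sum_{n=0}^\infty\frac{q^{(n+k+1)(k+1)}}{(q^{n+k+1};q)_\infty}$, where $(a;q)_m=\prod_{i=0}^{m-1}(1-aq^i)$ and $(a;q)_\infty=\prod_{i=0}^{\infty}(1-aq^i)$. *)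

theory Defs
  imports Main "HOL-Library.Multiset"
begin

definition partitions :: "nat \<Rightarrow> nat multiset set" where
  "partitions n = {M. 0 \<notin># M \<and> sum_mset M = n}"

lemma finite_partitions: "finite (partitions n)"
proof (rule finite_subset)
  show "partitions n \<subseteq> mset ` {xs. set xs \<subseteq> {0..n} \<and> length xs \<le> n}"
  proof
    fix M assume M: "M \<in> partitions n"
    obtain xs where xs: "M = mset xs" by (metis ex_mset)
    have pos: "0 \<notin> set xs" and s: "sum_list xs = n"
      using M xs by (auto simp: partitions_def sum_mset_sum_list)
    have "length xs \<le> sum_list xs" using pos
      by (induction xs) auto
    moreover have "set xs \<subseteq> {0..n}" using s member_le_sum_list by fastforce
    ultimately show "M \<in> mset ` {xs. set xs \<subseteq> {0..n} \<and> length xs \<le> n}"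
      using s xs by auto
  qed
  show "finite (mset ` {xs. set xs \<subseteq> {0..n} \<and> length xs \<le> n})"
    by (intro finite_imageI finite_lists_length_le) simp
qed

text \<open>The partition function takes an integer argument because it is extended by zero to
  negative arguments.\<close>

definition p :: "int \<Rightarrow> nat" where
  "p m = (if m < 0 then 0 else card (partitions (nat m)))"

definition regular_partitions :: "nat \<Rightarrow> nat \<Rightarrow> nat multiset set" where
  "regular_partitions l n = {M \<in> partitions n. \<forall>x \<in># M. \<not> l dvd x}"

definition b6 :: "nat \<Rightarrow> nat" where
  "b6 n = card (regular_partitions 6 n)"

text \<open>The part \<open>m\<close> below is the smallest part exceeding \<open>k\<close>; its existence is part of the
  requirement.\<close>

definition P_tilde :: "nat \<Rightarrow> nat \<Rightarrow> nat" where
  "P_tilde k n = card {M \<in> partitions n.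
     (\<forall>i \<in> {1..k}. i \<in># M) \<and>
     (\<exists>m \<in># M. k < m \<and> (\<forall>x \<in># M. k < x \<longrightarrow> m \<le> x) \<and> k + 1 \<le> count M m)}"

text \<open>The sign of an integer index \<open>j\<close>, i.e. the power of \<open>-1\<close> with exponent \<open>j\<close>;
  integer exponents are not available over the integers.\<close>

definition alt_sign :: "int \<Rightarrow> int" where
  "alt_sign j = (-1) ^ nat \<bar>j\<bar>"

end

theory Submission
  imports Defs
begin

text \<open>
  With \<open>x = q\<^sup>K\<close>, Euler's series \<open>f(x) = \<Sum>n. x\<^sup>n (x;q)\<^sub>n\<close> satisfies
  \<open>f(x) + q x\<^sup>3 f(q x) = 1 + x\<close>. Up to a power of \<open>q\<close> and the factor \<open>1 / (q;q)\<^sub>\<infinity>\<close>, the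
  two series on the left are the generating functions of \<open>P_tilde (K - 1)\<close> and \<open>P_tilde K\<close>,
  so their sum is \<open>p(m - K(3K-1)/2) + p(m - K(3K+1)/2)\<close>. Induction on \<open>k\<close> then gives the
  truncated pentagonal number theorem for \<open>p\<close>, and convolving it with \<open>b6\<close> in \<open>q\<^sup>6\<close> gives
  the claim, because splitting off the parts divisible by \<open>6\<close> turns \<open>p\<close> into the convolution of
  \<open>b6\<close> with \<open>p\<close> in \<open>q\<^sup>6\<close>. The functional equation is proved coefficientwise, as a
  telescoping sum of counts of partitions with restricted parts.
\<close>

section \<open>Counting partitions with parts in a prescribed set\<close>

definition partitions_in :: "nat set \<Rightarrow> nat \<Rightarrow> nat multiset set" where
  "partitions_in A n = {M \<in> partitions n. set_mset M \<subseteq> A}"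

text \<open>An integer argument with value zero below 0 lets the recurrences below hold for every
  shift, without truncated subtraction.\<close>

definition num_partitions_in :: "nat set \<Rightarrow> int \<Rightarrow> int" where
  "num_partitions_in A m = (if m < 0 then 0 else int (card (partitions_in A (nat m))))"

lemma finite_partitions_in [simp]: "finite (partitions_in A n)"
  by (simp add: partitions_in_def finite_partitions)

lemma num_partitions_in_neg [simp]: "m < 0 \<Longrightarrow> num_partitions_in A m = 0"
  by (simp add: num_partitions_in_def)

lemma num_partitions_in_UNIV: "num_partitions_in UNIV m = int (p m)"
  by (simp add: num_partitions_in_def partitions_in_def p_def)

lemma card_partitions_in_superset:
  assumes "set_mset B \<subseteq> A" "0 \<notin># B"
  shows "int (card {M \<in> partitions_in A n. B \<subseteq># M})
           = num_partitions_in A (int n - int (sum_mset B))"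
proof (cases "sum_mset B \<le> n")
  case True
  have "bij_betw (\<lambda>M. M + B) (partitions_in A (n - sum_mset B)) {M \<in> partitions_in A n. B \<subseteq># M}"
    by (rule bij_betw_byWitness[where f' = "\<lambda>M. M - B"])
       (use assms True in \<open>auto simp: partitions_in_def partitions_def sum_mset_diff
          dest: in_diffD\<close>)
  then have "card (partitions_in A (n - sum_mset B)) = card {M \<in> partitions_in A n. B \<subseteq># M}"
    by (rule bij_betw_same_card)
  moreover have "nat (int n - int (sum_mset B)) = n - sum_mset B"
    by linarith
  ultimately show ?thesis
    using True by (simp add: num_partitions_in_def del: of_nat_sum_mset)
next
  case False
  have "sum_mset B \<le> n" if "M \<in> partitions n" "B \<subseteq># M" for M
    using that by (auto simp: partitions_def mset_subset_eq_exists_conv)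
  then have "{M \<in> partitions_in A n. B \<subseteq># M} = {}"
    using False by (auto simp: partitions_in_def)
  then show ?thesis
    using False by (simp del: of_nat_sum_mset)
qed

text \<open>Either \<open>a\<close> does not occur, or one copy of it can be removed.\<close>

lemma num_partitions_in_insert:
  assumes "a \<notin> A" "a > 0"
  shows "num_partitions_in (insert a A) m
           = num_partitions_in A m + num_partitions_in (insert a A) (m - int a)"
proof (cases "m < 0")
  case False
  define n where "n = nat m"
  have m: "m = int n"
    using False by (simp add: n_def)
  have "partitions_in (insert a A) n =
      partitions_in A n \<union> {M \<in> partitions_in (insert a A) n. {#a#} \<subseteq># M}"
    by (auto simp: partitions_in_def)
  moreover have "partitions_in A n \<inter> {M \<in> partitions_in (insert a A) n. {#a#} \<subseteq># M} = {}"
    using assms by (auto simp: partitions_in_def)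
  ultimately have "card (partitions_in (insert a A) n) =
      card (partitions_in A n) + card {M \<in> partitions_in (insert a A) n. {#a#} \<subseteq># M}"
    by (metis (no_types, lifting) card_Un_disjoint finite_Un finite_partitions_in)
  then show ?thesis
    using card_partitions_in_superset[of "{#a#}" "insert a A" n] assms
    by (simp add: num_partitions_in_def m)
qed (use assms in simp)

section \<open>The functional equation in terms of gap counts\<close>

text \<open>The parts strictly between \<open>k\<close> and \<open>m\<close> are forbidden. With
  \<open>x = q^(k+1)\<close> and \<open>m = k+1+i\<close>, the generating function is
  \<open>(x;q)_i / (q;q)_inf\<close>, a term of Euler's series up to a power of
  \<open>x\<close>.\<close>

definition num_gap :: "nat \<Rightarrow> nat \<Rightarrow> int \<Rightarrow> int" where
  "num_gap k m = num_partitions_in ({..k} \<union> {m..})"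

lemma num_gap_neg [simp]: "r < 0 \<Longrightarrow> num_gap k m r = 0"
  by (simp add: num_gap_def)

lemma num_gap_Suc_self: "num_gap k (Suc k) r = int (p r)"
proof -
  have "{..k} \<union> {Suc k..} = UNIV"
    by auto
  then show ?thesis
    by (simp add: num_gap_def num_partitions_in_UNIV)
qed

lemma num_gap_Suc_left:
  assumes "Suc k < m"
  shows "num_gap (Suc k) m r = num_gap k m r + num_gap (Suc k) m (r - int (Suc k))"
proof -
  have "{..Suc k} \<union> {m..} = insert (Suc k) ({..k} \<union> {m..})"
    by auto
  then show ?thesis
    using num_partitions_in_insert[of "Suc k" "{..k} \<union> {m..}" r] assms
    by (simp add: num_gap_def)
qed

lemma num_gap_Suc_right:
  assumes "k < m"
  shows "num_gap k m r = num_gap k (Suc m) r + num_gap k m (r - int m)"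
proof -
  have "{..k} \<union> {m..} = insert m ({..k} \<union> {Suc m..})"
    by auto
  then show ?thesis
    using num_partitions_in_insert[of m "{..k} \<union> {Suc m..}" r] assms
    by (simp add: num_gap_def)
qed

text \<open>The functional equation of \<open>f\<close>, truncated after \<open>N\<close> steps, with \<open>K = Suc k\<close>.\<close>

lemma euler_telescope:
  "(\<Sum>i\<le>N. num_gap k (Suc k + i) (r - int i * int (Suc k))) +
   (\<Sum>i<N. num_gap (Suc k) (Suc (Suc k) + i)
       (r - int (Suc i) * int (Suc (Suc k)) - 2 * int (Suc k)))
   = int (p r) + int (p (r - int (Suc k)))
     - num_gap (Suc k) (Suc (Suc k) + N) (r - int (Suc N) * int (Suc k))"
proof (induction N)
  case 0
  then show ?case
    using num_gap_Suc_self[of k r] num_gap_Suc_self[of "Suc k"] by simp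
next
  case (Suc N)
  define m where "m = Suc (Suc k) + N"
  define s where "s = r - int (Suc N) * int (Suc k)"
  \<comment> \<open>This is \<open>(x;q)_(N+1) = (1 - x) (qx;q)_N\<close>: the old remainder is the
    new term of the first sum plus \<open>x^(N+2) (qx;q)_N\<close>.\<close>
  have "num_gap (Suc k) m s = num_gap k m s + num_gap (Suc k) m (s - int (Suc k))"
    by (rule num_gap_Suc_left) (simp add: m_def)
  \<comment> \<open>Splitting by the occurrence of the part \<open>m\<close> gives the new remainder
    and the new term of the second sum.\<close>
  moreover have "num_gap (Suc k) m (s - int (Suc k)) =
      num_gap (Suc k) (Suc m) (s - int (Suc k)) + num_gap (Suc k) m (s - int (Suc k) - int m)"
    by (rule num_gap_Suc_right) (simp add: m_def)
  moreover have "s - int (Suc k) = r - int (Suc (Suc N)) * int (Suc k)"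
    by (simp add: s_def algebra_simps)
  moreover have "s - int (Suc k) - int m =
      r - int (Suc N) * int (Suc (Suc k)) - 2 * int (Suc k)"
    by (simp add: s_def m_def algebra_simps)
  moreover have "Suc k + Suc N = m" "Suc (Suc k) + Suc N = Suc m"
    by (simp_all add: m_def)
  ultimately show ?case
    using Suc.IH unfolding sum.atMost_Suc sum.lessThan_Suc m_def[symmetric] s_def[symmetric]
    by (simp only:)
qed

section \<open>\<open>P_tilde\<close> as a sum of gap counts\<close>

definition base_parts :: "nat \<Rightarrow> nat \<Rightarrow> nat multiset" where
  "base_parts k m = mset_set {1..k} + replicate_mset (Suc k) m"

lemma sum_base_parts: "sum_mset (base_parts k m) = \<Sum>{1..k} + Suc k * m"
  by (simp add: base_parts_def sum_unfold_sum_mset)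

lemma base_parts_subseteq_iff:
  assumes "k < m"
  shows "base_parts k m \<subseteq># M \<longleftrightarrow> (\<forall>i\<in>{1..k}. i \<in># M) \<and> k + 1 \<le> count M m"
proof -
  have "count (base_parts k m) i = (if i \<in> {1..k} then 1 else if i = m then Suc k else 0)" for i
    using assms by (auto simp: base_parts_def count_mset_set')
  then show ?thesis
    using assms by (auto simp: subseteq_mset_def Suc_le_eq)
qed

text \<open>Classify by the smallest part \<open>m\<close> above \<open>k\<close>: removing the
  compulsory parts \<open>base_parts k m\<close> leaves an arbitrary partition without parts
  strictly between \<open>k\<close> and \<open>m\<close>. The bound \<open>N\<close> stays free
  because the two sums in \<open>euler_telescope\<close> have different lengths.\<close>

lemma P_tilde_eq_sum:
  assumes "n \<le> N"
  shows "int (P_tilde k n) =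
    (\<Sum>i<N. num_gap k (Suc k + i) (int n - int (\<Sum>{1..k}) - int (Suc k) * int (Suc k + i)))"
proof -
  define S where
    "S m = {M \<in> partitions_in ({..k} \<union> {m..}) n. base_parts k m \<subseteq># M}" for m
  have "{M \<in> partitions n. (\<forall>i \<in> {1..k}. i \<in># M) \<and>
     (\<exists>m \<in># M. k < m \<and> (\<forall>x \<in># M. k < x \<longrightarrow> m \<le> x) \<and> k + 1 \<le> count M m)}
     = (\<Union>m\<in>{Suc k..<Suc k + N}. S m)" (is "?L = ?R")
  proof (intro equalityI subsetI)
    fix M assume M: "M \<in> ?L"
    then obtain m where m: "m \<in># M" "k < m" "\<forall>x \<in># M. k < x \<longrightarrow> m \<le> x" "k + 1 \<le> count M m"
      by blast
    have B: "base_parts k m \<subseteq># M"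
      using M m base_parts_subseteq_iff by auto
    have "set_mset M \<subseteq> {..k} \<union> {m..}"
      using m by (auto simp: not_le)
    with M B have "M \<in> S m"
      by (auto simp: S_def partitions_in_def)
    \<comment> \<open>A part is at most \<open>n\<close>, so \<open>N\<close> candidates starting at
      \<open>Suc k\<close> suffice.\<close>
    moreover have "m \<le> n"
      using M m(1) sum_mset.remove[of m M] by (auto simp: partitions_def)
    ultimately show "M \<in> ?R"
      using m(2) assms by auto
  next
    fix M assume "M \<in> ?R"
    then obtain m where m: "k < m" "M \<in> S m"
      by (auto simp: Suc_le_eq)
    then have *: "(\<forall>i\<in>{1..k}. i \<in># M) \<and> k + 1 \<le> count M m"
      using base_parts_subseteq_iff by (auto simp: S_def)
    then have "m \<in># M"
      by (auto simp: Suc_le_eq intro: count_inI)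
    moreover have "\<forall>x\<in>#M. k < x \<longrightarrow> m \<le> x"
      using m by (auto simp: S_def partitions_in_def)
    ultimately show "M \<in> ?L"
      using m * by (auto simp: S_def partitions_in_def)
  qed
  then have "P_tilde k n = card (\<Union>m\<in>{Suc k..<Suc k + N}. S m)"
    unfolding P_tilde_def by simp
  also have "\<dots> = (\<Sum>m\<in>{Suc k..<Suc k + N}. card (S m))"
  proof (rule card_UN_disjoint)
    \<comment> \<open>Since \<open>m'\<close> is a part of \<open>M\<close> above \<open>k\<close>,
      it lies beyond the gap that ends at \<open>m\<close>; exchanging the two gives equality, hence
      disjointness.\<close>
    have "m \<le> m'" if "k < m" "k < m'" "M \<in> S m" "M \<in> S m'" for M m m'
    proof -
      have "k + 1 \<le> count M m'"
        using that base_parts_subseteq_iff by (auto simp: S_def)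
      then have "m' \<in># M"
        by (auto simp: Suc_le_eq intro: count_inI)
      then show ?thesis
        using that by (auto simp: S_def partitions_in_def)
    qed
    then show "\<forall>i\<in>{Suc k..<Suc k + N}. \<forall>j\<in>{Suc k..<Suc k + N}. i \<noteq> j \<longrightarrow> S i \<inter> S j = {}"
      by (intro ballI impI equals0I) (meson IntD1 IntD2 Suc_le_lessD atLeastLessThan_iff le_antisym)
  qed (simp_all add: S_def)
  finally have "int (P_tilde k n) = (\<Sum>m\<in>{Suc k..<Suc k + N}. int (card (S m)))"
    by simp
  also have "\<dots> = (\<Sum>m\<in>{Suc k..<Suc k + N}.
      num_gap k m (int n - int (\<Sum>{1..k}) - int (Suc k) * int m))"
  proof (rule sum.cong)
    fix m assume "m \<in> {Suc k..<Suc k + N}"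
    then have "set_mset (base_parts k m) \<subseteq> {..k} \<union> {m..}" "0 \<notin># base_parts k m"
      by (auto simp: base_parts_def split: if_splits)
    from card_partitions_in_superset[OF this]
    show "int (card (S m)) = num_gap k m (int n - int (\<Sum>{1..k}) - int (Suc k) * int m)"
      unfolding S_def num_gap_def
      by (simp only: sum_base_parts of_nat_add of_nat_mult diff_diff_eq)
  qed simp
  also have "\<dots> = (\<Sum>i<N. num_gap k (Suc k + i)
      (int n - int (\<Sum>{1..k}) - int (Suc k) * int (Suc k + i)))"
    by (rule sum.reindex_bij_witness[of _ "\<lambda>i. Suc k + i" "\<lambda>m. m - Suc k"]) auto
  finally show ?thesis .
qed

section \<open>The truncated pentagonal number theorem\<close>

definition pentagonal :: "int \<Rightarrow> int" where
  "pentagonal j = j * (3 * j - 1) div 2"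

lemma two_pentagonal: "2 * pentagonal j = j * (3 * j - 1)"
  unfolding pentagonal_def by (rule dvd_mult_div_cancel) auto

lemma two_sum_int: "2 * int (\<Sum>{1..k}) = int k * (int k + 1)"
  by (induction k) (simp_all add: algebra_simps)

lemma P_tilde_add_Suc:
  "int (P_tilde k n) + int (P_tilde (Suc k) n)
     = int (p (int n - pentagonal (int (Suc k)))) + int (p (int n - pentagonal (- int (Suc k))))"
proof -
  \<comment> \<open>With \<open>K = Suc k\<close>, the compulsory parts for the least choice
    \<open>m = K\<close> sum to \<open>K(K-1)/2 + K^2 = K(3K-1)/2\<close>.\<close>
  define r where "r = int n - pentagonal (int (Suc k))"
  have "int n - int (\<Sum>{1..k}) - int (Suc k) * int (Suc k + i) = r - int i * int (Suc k)" for i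
    using two_sum_int[of k] two_pentagonal[of "int (Suc k)"]
    by (simp add: r_def algebra_simps)
  then have 1: "int (P_tilde k n) =
      (\<Sum>i\<le>n. num_gap k (Suc k + i) (r - int i * int (Suc k)))"
    using P_tilde_eq_sum[of n "Suc n" k] by (simp only: le_SucI[OF order_refl] lessThan_Suc_atMost)
  have "int n - int (\<Sum>{1..Suc k}) - int (Suc (Suc k)) * int (Suc (Suc k) + i)
      = r - int (Suc i) * int (Suc (Suc k)) - 2 * int (Suc k)" for i
    using two_sum_int[of "Suc k"] two_pentagonal[of "int (Suc k)"]
    by (simp add: r_def algebra_simps)
  then have 2: "int (P_tilde (Suc k) n) = (\<Sum>i<n. num_gap (Suc k) (Suc (Suc k) + i)
       (r - int (Suc i) * int (Suc (Suc k)) - 2 * int (Suc k)))"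
    using P_tilde_eq_sum[of n n "Suc k"] by (simp only: order_refl)
  have pent: "int n - pentagonal (- int (Suc k)) = r - int (Suc k)"
    using two_pentagonal[of "int (Suc k)"] two_pentagonal[of "- int (Suc k)"]
    by (simp add: r_def algebra_simps)
  \<comment> \<open>At \<open>N = n\<close> the remainder of the telescope has a negative argument,
    because \<open>r\<close> is at most \<open>n\<close>.\<close>
  have "2 * pentagonal (int (Suc k)) \<ge> 0"
    unfolding two_pentagonal by simp
  then have "r \<le> int n"
    by (simp add: r_def)
  also have "int n < int (Suc n) * int (Suc k)"
    by (simp add: algebra_simps add_pos_nonneg)
  finally have "r - int (Suc n) * int (Suc k) < 0"
    by simp
  then show ?thesis
    using euler_telescope[of k r n] unfolding 1 2 pent by (simp add: r_def)
qed

text \<open>For \<open>k = 0\<close> the smallest part only has to exist, which excludes just the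
  empty partition.\<close>

lemma P_tilde_0: "int (P_tilde 0 n) = int (p (int n)) - (if n = 0 then 1 else 0)"
proof -
  have *: "(\<exists>m\<in>#M. 0 < m \<and> (\<forall>x\<in>#M. 0 < x \<longrightarrow> m \<le> x) \<and> 1 \<le> count M m) \<longleftrightarrow> M \<noteq> {#}"
    if "M \<in> partitions n" for M
  proof
    assume "M \<noteq> {#}"
    then have "Min (set_mset M) \<in># M" "\<forall>x\<in>#M. Min (set_mset M) \<le> x"
      by simp_all
    then show "\<exists>m\<in>#M. 0 < m \<and> (\<forall>x\<in>#M. 0 < x \<longrightarrow> m \<le> x) \<and> 1 \<le> count M m"
      using that by (intro bexI[of _ "Min (set_mset M)"]) (auto simp: partitions_def Suc_le_eq intro: gr0I)
  qed auto
  have "P_tilde 0 n = card (partitions n - {{#}})"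
    unfolding P_tilde_def by (rule arg_cong[where f = card]) (use * in auto)
  moreover have "{#} \<in> partitions n \<longleftrightarrow> n = 0"
    by (auto simp: partitions_def)
  moreover have "card (partitions n) > 0" if "n = 0"
    using that finite_partitions[of n] \<open>{#} \<in> partitions n \<longleftrightarrow> n = 0\<close>
    by (auto simp: card_gt_0_iff)
  ultimately show ?thesis
    using finite_partitions by (auto simp: p_def card_Diff_singleton)
qed

text \<open>Passing to \<open>Suc k\<close> adds the indices \<open>Suc k\<close> and
  \<open>- Suc k\<close>. By \<open>P_tilde_add_Suc\<close> they contribute
  \<open>P_tilde k n + P_tilde (Suc k) n\<close> with sign \<open>(-1)^(k+1)\<close>, so the old
  error term cancels.\<close>

lemma truncated_pentagonal:
  "(\<Sum>j = - int k..int k. alt_sign j * int (p (int n - pentagonal j)))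
     = (if n = 0 then 1 else 0) + (-1) ^ k * int (P_tilde k n)"
proof (induction k)
  case 0
  then show ?case
    by (simp add: P_tilde_0 alt_sign_def pentagonal_def)
next
  case (Suc k)
  have "{- int (Suc k)..int (Suc k)} = insert (- int (Suc k)) (insert (int (Suc k)) {- int k..int k})"
    by auto
  then have "(\<Sum>j = - int (Suc k)..int (Suc k). alt_sign j * int (p (int n - pentagonal j))) =
      (-1) ^ Suc k * (int (p (int n - pentagonal (int (Suc k)))) + int (p (int n - pentagonal (- int (Suc k)))))
      + (\<Sum>j = - int k..int k. alt_sign j * int (p (int n - pentagonal j)))"
    by (simp add: alt_sign_def nat_add_distrib algebra_simps)
  then show ?case
    unfolding Suc.IH P_tilde_add_Suc[symmetric] by (simp add: algebra_simps)
qed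

section \<open>Splitting off the parts divisible by \<open>l\<close>\<close>

text \<open>The multiples of \<open>l\<close> in a partition, divided by \<open>l\<close>, form an
  arbitrary partition of some \<open>j\<close>; the other parts form an \<open>l\<close>-regular
  partition of \<open>n - l * j\<close>.\<close>

lemma card_partitions_convolution:
  assumes "l > 0"
  shows "card (partitions n) =
    (\<Sum>j = 0..n div l. card (regular_partitions l (n - l * j)) * card (partitions j))"
proof -
  define T where "T j = regular_partitions l (n - l * j) \<times> partitions j" for j
  define h where "h = (\<lambda>(R, Q). R + image_mset ((*) l) Q)"
  have sum_image: "sum_mset (image_mset ((*) l) Q) = l * sum_mset Q" for Q
    by (induction Q) (simp_all add: algebra_simps)
  \<comment> \<open>Divisibility by \<open>l\<close> recovers both summands from the merged
    multiset, which makes \<open>h\<close> injective.\<close>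
  have split: "filter_mset (\<lambda>x. \<not> l dvd x) (R + image_mset ((*) l) Q) = R"
    "filter_mset (\<lambda>x. l dvd x) (R + image_mset ((*) l) Q) = image_mset ((*) l) Q"
    if "\<forall>x\<in>#R. \<not> l dvd x" for R Q
  proof -
    have "filter_mset (\<lambda>x. \<not> l dvd x) R = R" "filter_mset (\<lambda>x. l dvd x) R = {#}"
      using that by (auto simp: filter_mset_eq_conv)
    then show "filter_mset (\<lambda>x. \<not> l dvd x) (R + image_mset ((*) l) Q) = R"
      "filter_mset (\<lambda>x. l dvd x) (R + image_mset ((*) l) Q) = image_mset ((*) l) Q"
      by (simp_all add: filter_mset_image_mset)
  qed
  have inj: "inj (image_mset ((*) l))"
    using assms by (intro multiset.inj_map) (auto intro: injI)
  have "inj_on h (\<Union>j\<in>{0..n div l}. T j)"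
  proof (rule inj_onI)
    fix x y assume x: "x \<in> (\<Union>j\<in>{0..n div l}. T j)" and y: "y \<in> (\<Union>j\<in>{0..n div l}. T j)"
      and eq: "h x = h y"
    obtain R Q R' Q' where xy: "x = (R, Q)" "y = (R', Q')"
      by (metis surj_pair)
    have "\<forall>x\<in>#R. \<not> l dvd x" "\<forall>x\<in>#R'. \<not> l dvd x"
      using x y by (auto simp: xy T_def regular_partitions_def)
    then have "R = R'" "image_mset ((*) l) Q = image_mset ((*) l) Q'"
      using split eq unfolding xy h_def by (metis old.prod.case)+
    then show "x = y"
      using inj by (simp add: xy inj_eq)
  qed
  moreover have "h ` (\<Union>j\<in>{0..n div l}. T j) = partitions n"
  proof (intro equalityI subsetI)
    fix M assume "M \<in> h ` (\<Union>j\<in>{0..n div l}. T j)"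
    then obtain j R Q where j: "j \<le> n div l" and RQ: "R \<in> regular_partitions l (n - l * j)"
      "Q \<in> partitions j" and M: "M = R + image_mset ((*) l) Q"
      by (auto simp: T_def h_def)
    have "l * j \<le> n"
      using j assms by (simp add: less_eq_div_iff_mult_less_eq mult.commute)
    then show "M \<in> partitions n"
      using RQ assms by (auto simp: M regular_partitions_def partitions_def sum_image)
  next
    fix M assume M: "M \<in> partitions n"
    define R where "R = filter_mset (\<lambda>x. \<not> l dvd x) M"
    define Q where "Q = image_mset (\<lambda>x. x div l) (filter_mset (\<lambda>x. l dvd x) M)"
    have "image_mset ((*) l) Q = image_mset (\<lambda>x. x) (filter_mset (\<lambda>x. l dvd x) M)"
      unfolding Q_def image_mset.compositionality by (rule image_mset_cong) auto
    then have h: "M = R + image_mset ((*) l) Q"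
      by (simp add: R_def)
    then have n: "n = sum_mset R + l * sum_mset Q"
      using M sum_image by (metis (mono_tags, lifting) mem_Collect_eq partitions_def sum_mset.union)
    moreover have "0 \<notin># Q"
      using M by (auto simp: Q_def partitions_def dvd_div_eq_0_iff)
    ultimately have "(R, Q) \<in> T (sum_mset Q)"
      using M by (auto simp: T_def regular_partitions_def partitions_def R_def)
    moreover have "sum_mset Q \<le> n div l"
      using n assms by (simp add: less_eq_div_iff_mult_less_eq mult.commute)
    ultimately show "M \<in> h ` (\<Union>j\<in>{0..n div l}. T j)"
      using h by (intro image_eqI[of _ _ "(R, Q)"]) (auto simp: h_def)
  qed
  ultimately have "card (partitions n) = card (\<Union>j\<in>{0..n div l}. T j)"
    using card_image by fastforce
  also have "\<dots> = (\<Sum>j\<in>{0..n div l}. card (T j))"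
  proof (rule card_UN_disjoint)
    show "\<forall>j\<in>{0..n div l}. finite (T j)"
      by (simp add: T_def regular_partitions_def finite_partitions)
  qed (auto simp: T_def partitions_def)
  finally show ?thesis
    by (simp add: T_def card_cartesian_product)
qed

lemma p_convolution_b6:
  assumes "e \<ge> 0"
  shows "int (p (int n - 6 * e)) = (\<Sum>j = 0..n div 6. int (b6 (n - 6 * j)) * int (p (int j - e)))"
proof (cases "6 * e \<le> int n")
  case True
  define d where "d = nat e"
  have e: "e = int d" and d: "6 * d \<le> n"
    using True assms by (auto simp: d_def)
  have "int n - 6 * e = int (n - 6 * d)"
    using d by (simp add: e of_nat_diff)
  then have "int (p (int n - 6 * e)) = int (card (partitions (n - 6 * d)))"
    by (simp add: p_def)
  also have "\<dots> = (\<Sum>j = 0..(n - 6 * d) div 6.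
      int (b6 (n - 6 * d - 6 * j)) * int (card (partitions j)))"
    by (subst card_partitions_convolution[of 6]) (simp_all add: b6_def)
  \<comment> \<open>Shift the index by \<open>d\<close>; the terms with \<open>j < d\<close> can
    then be added because \<open>p\<close> vanishes at negative arguments.\<close>
  also have "\<dots> = (\<Sum>j = d..n div 6. int (b6 (n - 6 * j)) * int (p (int j - e)))"
    by (rule sum.reindex_bij_witness[of _ "\<lambda>j. j - d" "\<lambda>j. j + d"])
       (use d in \<open>auto simp: e p_def algebra_simps nat_diff_distrib\<close>)
  also have "\<dots> = (\<Sum>j = 0..n div 6. int (b6 (n - 6 * j)) * int (p (int j - e)))"
    by (rule sum.mono_neutral_left) (auto simp: e p_def)
  finally show ?thesis .
next
  case False
  then have "int j - e < 0" if "j \<le> n div 6" for j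
    using that by linarith
  then show ?thesis
    using False by (simp add: p_def)
qed

section \<open>Convolution of the truncated identity with \<open>b6\<close>\<close>

theorem theorem1p9:
  fixes n k :: nat
  assumes "k > 0"
  shows "(-1) ^ (k - 1) *
           (int (b6 n) - (\<Sum>j = - int k..int k. alt_sign j * int (p (int n - 3 * j * (3 * j - 1)))))
         = (\<Sum>j = 0..n div 6. int (b6 (n - 6 * j)) * int (P_tilde k j))"
proof -
  \<comment> \<open>The factor 6 lets \<open>p_convolution_b6\<close> apply with
    \<open>e = pentagonal j\<close>, so the sum over \<open>j\<close> can be evaluated inside the
    convolution.\<close>
  have pent: "3 * j * (3 * j - 1) = 6 * pentagonal j" for j
    using two_pentagonal[of j] by simp
  have nonneg: "pentagonal j \<ge> 0" for j
  proof -
    have "0 \<le> j * (3 * j - 1)"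
      by (cases "j \<le> 0") (auto intro: mult_nonpos_nonpos mult_nonneg_nonneg)
    then show ?thesis
      by (simp add: pentagonal_def)
  qed
  have "(\<Sum>j = - int k..int k. alt_sign j * int (p (int n - 3 * j * (3 * j - 1)))) =
      (\<Sum>j = - int k..int k. \<Sum>i = 0..n div 6.
         int (b6 (n - 6 * i)) * (alt_sign j * int (p (int i - pentagonal j))))"
    unfolding pent p_convolution_b6[OF nonneg] by (simp add: sum_distrib_left mult_ac)
  also have "\<dots> = (\<Sum>i = 0..n div 6. int (b6 (n - 6 * i)) *
      (\<Sum>j = - int k..int k. alt_sign j * int (p (int i - pentagonal j))))"
    by (subst sum.swap) (simp add: sum_distrib_left)
  also have "\<dots> = (\<Sum>i = 0..n div 6. int (b6 (n - 6 * i)) * (if i = 0 then 1 else 0)) +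
      (-1) ^ k * (\<Sum>i = 0..n div 6. int (b6 (n - 6 * i)) * int (P_tilde k i))"
    unfolding truncated_pentagonal by (simp add: distrib_left sum.distrib sum_distrib_left mult_ac)
  also have "(\<Sum>i = 0..n div 6. int (b6 (n - 6 * i)) * (if i = 0 then 1 else 0)) = int (b6 n)"
    by (simp add: if_distrib sum.delta cong: if_cong)
  finally have "int (b6 n) - (\<Sum>j = - int k..int k. alt_sign j * int (p (int n - 3 * j * (3 * j - 1))))
      = (-1) ^ (k - 1) * (\<Sum>i = 0..n div 6. int (b6 (n - 6 * i)) * int (P_tilde k i))"
    using assms by (cases k) simp_all
  \<comment> \<open>The two factors \<open>(-1)^(k-1)\<close> multiply to 1.\<close>
  then show ?thesis
    by (simp flip: mult.assoc power_add)
qed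

end
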